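(* Let $P$ and $\tilde P$ be irreducible, positive recurrent stochastic matrices (possibly periodic) on a countable (finite or infinite) state space $\mathbb{E}$, with unique invariant probability measures $\pi$ and $\nu$ respectively, and let $\Delta=\tilde P-P$. Let $i_0$ be any fixed state in $\mathbb{E}$. Suppose that there exists a bounded non-negative function $V$ on $\mathbb{E}$ such that $V(i_0)=0$ and $$\sum_{j\in\mathbb{E}}P(i,j)V(j)\le V(i)-1\qquad\text{for all } i\ne i_0 .$$ Then $$\|\nu-\pi\|\le 2\Big(\sup_{i\in\mathbb{E}}V(i)\Big)^2\|\Delta\|,$$ and $$\|\nu-\pi\|\le 2\inf_{k\in\mathbb{E}}\Big(\sup_{i\in\mathbb{E}}m_{ik}\Big)^2\|\Delta\|.$$
   Context: Let $\Phi(n)$ be the discrete-time Markov chain with transition matrix $P$. For $j\in\mathbb{E}$, $\sigma_j=\inf\{n\ge 0:\Phi(n)=j\}$ is the first hitting time of $j$, and $m_{ij}=E_i[\sigma_j]$ is its expectation when the chain starts at $i$ (so $m_{ii}=0$). Norms: for a signed finite measure (row vector) $\mu$ on $\mathbb{E}$, $\|\mu\|=\sum_{i\in\mathbb{E}}|\mu(i)|$; for a matrix $L=(L_{ij})$ on $\mathbb{E}\times\mathbb{E}$, $\|L\|=\sup_{i\in\mathbb{E}}\sum_{j\in\mathbb{E}}|L_{ij}|$. *)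

theory Defs
  imports "HOL-Probability.Probability"
begin

text \<open>
  A stochastic matrix on a countable state space \<open>'a\<close> is a map \<open>P :: 'a \<Rightarrow> 'a pmf\<close> whose
  \<open>i\<close>-th row is the distribution \<open>P i\<close>, so that \<open>pmf (P i) j\<close> is the entry \<open>P(i,j)\<close>.
\<close>

primrec nstep :: "('a \<Rightarrow> 'a pmf) \<Rightarrow> nat \<Rightarrow> 'a \<Rightarrow> 'a pmf" where
  "nstep P 0 i = return_pmf i"
| "nstep P (Suc n) i = bind_pmf (P i) (nstep P n)"

definition irreducible_chain :: "('a \<Rightarrow> 'a pmf) \<Rightarrow> bool" where
  "irreducible_chain P \<longleftrightarrow> (\<forall>i j. \<exists>n. 0 < pmf (nstep P n i) j)"

definition invariant_pmf :: "('a \<Rightarrow> 'a pmf) \<Rightarrow> 'a pmf \<Rightarrow> bool" where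
  "invariant_pmf P \<pi> \<longleftrightarrow> bind_pmf \<pi> P = \<pi>"

text \<open>
  The chain is realised on the space of independent variables \<open>\<omega> (n, i)\<close> with law \<open>P i\<close>:
  at time \<open>n\<close>, a chain in state \<open>i\<close> moves to \<open>\<omega> (n, i)\<close>. The lemmas \<open>measurable_chain\<close> and
  \<open>chain_finite_paths\<close> below show that this is the Markov chain with transition matrix \<open>P\<close>
  started at \<open>i\<close>.
\<close>

definition chain_space :: "('a \<Rightarrow> 'a pmf) \<Rightarrow> (nat \<times> 'a \<Rightarrow> 'a) measure" where
  "chain_space P = (\<Pi>\<^sub>M x\<in>UNIV. measure_pmf (P (snd x)))"

primrec chain :: "'a \<Rightarrow> nat \<Rightarrow> (nat \<times> 'a \<Rightarrow> 'a) \<Rightarrow> 'a" where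
  "chain i 0 \<omega> = i"
| "chain i (Suc n) \<omega> = \<omega> (n, chain i n \<omega>)"

text \<open>In both definitions the infimum of the empty set is \<open>\<infinity>\<close>.\<close>

definition hitting_time :: "(nat \<Rightarrow> 'a) \<Rightarrow> 'a \<Rightarrow> ennreal" where
  "hitting_time \<phi> j = (INF n\<in>{n. \<phi> n = j}. of_nat n)"

definition return_time :: "(nat \<Rightarrow> 'a) \<Rightarrow> 'a \<Rightarrow> ennreal" where
  "return_time \<phi> j = (INF n\<in>{n. 1 \<le> n \<and> \<phi> n = j}. of_nat n)"

definition mean_hitting_time :: "('a \<Rightarrow> 'a pmf) \<Rightarrow> 'a \<Rightarrow> 'a \<Rightarrow> ennreal" where
  "mean_hitting_time P i j = (\<integral>\<^sup>+\<omega>. hitting_time (\<lambda>n. chain i n \<omega>) j \<partial>chain_space P)"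

definition positive_recurrent :: "('a \<Rightarrow> 'a pmf) \<Rightarrow> bool" where
  "positive_recurrent P \<longleftrightarrow>
     (\<forall>i. (\<integral>\<^sup>+\<omega>. return_time (\<lambda>n. chain i n \<omega>) i \<partial>chain_space P) < \<infinity>)"

definition vector_norm :: "('a \<Rightarrow> real) \<Rightarrow> ennreal" where
  "vector_norm \<mu> = (\<Sum>\<^sub>\<infinity>i. ennreal \<bar>\<mu> i\<bar>)"

definition matrix_norm :: "('a \<Rightarrow> 'a \<Rightarrow> real) \<Rightarrow> ennreal" where
  "matrix_norm L = (SUP i. \<Sum>\<^sub>\<infinity>j. ennreal \<bar>L i j\<bar>)"

lemma space_chain_space [simp]: "space (chain_space P) = UNIV"
  by (simp add: chain_space_def space_PiM PiE_UNIV_domain)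

lemma prob_space_chain_space: "prob_space (chain_space P)"
  unfolding chain_space_def by (intro prob_space_PiM prob_space_measure_pmf)

lemma measurable_chain [measurable]:
  fixes P :: "'a::countable \<Rightarrow> 'a pmf"
  shows "chain i n \<in> measurable (chain_space P) (count_space UNIV)"
proof (induction n)
  case 0
  then show ?case by simp
next
  case (Suc n)
  note [measurable] = Suc
  have [measurable]: "(\<lambda>\<omega>. \<omega> x) \<in> measurable (chain_space P) (count_space UNIV)" for x
  proof -
    have "(\<lambda>\<omega>. \<omega> x) \<in> measurable (chain_space P) (measure_pmf (P (snd x)))"
      unfolding chain_space_def by (rule measurable_component_singleton) simp
    also have "measurable (chain_space P) (measure_pmf (P (snd x))) =
        measurable (chain_space P) (count_space UNIV)"
      by (rule measurable_cong_sets) auto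
    finally show ?thesis .
  qed
  have "(\<lambda>\<omega>. (\<lambda>j \<omega>. \<omega> (n, j)) (chain i n \<omega>) \<omega>) \<in> measurable (chain_space P) (count_space UNIV)"
    by (rule measurable_compose_countable) auto
  then show ?case by simp
qed

lemma chain_finite_paths:
  fixes P :: "'a::countable \<Rightarrow> 'a pmf"
  shows "measure (chain_space P) {\<omega>. \<forall>k\<le>n. chain i k \<omega> = x k} =
           (if x 0 = i then \<Prod>k<n. pmf (P (x k)) (x (Suc k)) else 0)"
proof (cases "x 0 = i")
  case False
  then have "{\<omega>. \<forall>k\<le>n. chain i k \<omega> = x k} = {}"
    by (metis (mono_tags, lifting) chain.simps(1) empty_Collect_eq zero_le)
  with False show ?thesis by (simp only: measure_empty if_False)
next
  case True
  interpret product_prob_space "\<lambda>y. measure_pmf (P (snd y))" "UNIV :: (nat \<times> 'a) set"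
    by unfold_locales
  let ?J = "(\<lambda>k. (k, x k)) ` {..<n}"
  have "(\<forall>k\<le>n. chain i k \<omega> = x k) \<longleftrightarrow> (\<forall>k<n. \<omega> (k, x k) = x (Suc k))" for \<omega>
  proof (induction n)
    case 0
    then show ?case using True by simp
  next
    case (Suc n)
    then show ?case by (auto simp: le_Suc_eq less_Suc_eq)
  qed
  then have "{\<omega>. \<forall>k\<le>n. chain i k \<omega> = x k} =
      prod_emb UNIV (\<lambda>y. measure_pmf (P (snd y))) ?J (Pi\<^sub>E ?J (\<lambda>y. {x (Suc (fst y))}))"
    by (auto simp: prod_emb_def PiE_iff)
  then have "measure (chain_space P) {\<omega>. \<forall>k\<le>n. chain i k \<omega> = x k} =
      (\<Prod>y\<in>?J. measure (measure_pmf (P (snd y))) {x (Suc (fst y))})"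
    unfolding chain_space_def by (simp add: measure_PiM_emb)
  also have "\<dots> = (\<Prod>k<n. pmf (P (x k)) (x (Suc k)))"
    by (subst prod.reindex) (auto simp: inj_on_def measure_pmf_single)
  finally show ?thesis using True by simp
qed

end

theory Submission
  imports Defs
begin

text \<open>
  Iterating the chain killed at \<open>i\<^sub>0\<close> solves \<open>g = f + P g\<close> off \<open>i\<^sub>0\<close>; for \<open>0 \<le> f \<le> 1\<close>
  the iterates increase and are dominated by \<open>V\<close>, so \<open>0 \<le> g \<le> V\<close>. If \<open>a\<close> and \<open>b\<close> are the solutions
  for \<open>f = 1\<^sub>A\<close> and \<open>f = 1\<close>, then \<open>g = a - \<pi>(A) b\<close> satisfies \<open>\<bar>g\<bar> \<le> sup V\<close> and
  \<open>(I - P) g = 1\<^sub>A - \<pi>(A)\<close>, also at \<open>i\<^sub>0\<close>, because both sides have \<open>\<pi>\<close>-mean \<open>0\<close> and \<open>\<pi>(i\<^sub>0) > 0\<close>.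
  Integrating against \<open>\<nu> = \<nu> P'\<close> gives \<open>\<nu>(A) - \<pi>(A) = \<nu> \<Delta> g \<le> (sup V) \<parallel>\<Delta>\<parallel>\<close>, and
  \<open>\<parallel>\<nu> - \<pi>\<parallel>\<close> is twice the maximum of the left-hand side over \<open>A\<close>. This bound is linear in \<open>sup V\<close>;
  the quadratic one follows since \<open>V \<ge> 1\<close> off \<open>i\<^sub>0\<close>, so that \<open>sup V\<close> is \<open>0\<close> or at least \<open>1\<close>.
  For the second bound, \<open>V = m\<^sub>\<cdot>\<^sub>k\<close> satisfies the drift condition by first-step analysis; this uses the
  law of the initial segments of the chain as a recursively defined distribution on lists.
\<close>

section \<open>Sums and expectations over probability mass functions\<close>

lemma infsum_ennreal:
  assumes "f summable_on A" and "\<And>x. x \<in> A \<Longrightarrow> 0 \<le> f x"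
  shows "(\<Sum>\<^sub>\<infinity>x\<in>A. ennreal (f x)) = ennreal (\<Sum>\<^sub>\<infinity>x\<in>A. f x)"
proof -
  have "(\<Sum>\<^sub>\<infinity>x\<in>A. ennreal (f x)) = (SUP F\<in>{F. finite F \<and> F \<subseteq> A}. \<Sum>x\<in>F. ennreal (f x))"
    by (rule nonneg_infsum_complete) simp
  also have "\<dots> = (SUP F\<in>{F. finite F \<and> F \<subseteq> A}. ennreal (sum f F))"
    using assms(2) by (intro SUP_cong refl sum_ennreal) auto
  also have "\<dots> = ennreal (\<Sum>\<^sub>\<infinity>x\<in>A. f x)"
    using assms by (rule infsum_nonneg_is_SUPREMUM_ennreal [symmetric])
  finally show ?thesis .
qed

lemma infsum_diff:
  fixes f g :: "'a \<Rightarrow> 'b::real_normed_vector"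
  assumes "f summable_on A" "g summable_on A"
  shows "(\<Sum>\<^sub>\<infinity>x\<in>A. f x - g x) = infsum f A - infsum g A"
  using infsum_add [of f A "\<lambda>x. - g x"] assms by (simp add: summable_on_uminus infsum_uminus)

lemma pmf_summable_on: "pmf p summable_on A"
  using pmf_abs_summable abs_summable_equivalent abs_summable_summable by blast

lemma pmf_diff_summable_on: "(\<lambda>x. pmf p x - pmf q x) summable_on A"
  using summable_on_add [OF pmf_summable_on [of p A] summable_on_uminus [THEN iffD2, OF pmf_summable_on [of q A]]]
  by simp

lemma abs_pmf_diff_summable_on: "(\<lambda>x. \<bar>pmf p x - pmf q x\<bar>) summable_on A"
  using pmf_diff_summable_on [THEN summable_on_iff_abs_summable_on_real [THEN iffD1]] by simp

lemma measure_pmf_eq_infsum: "measure_pmf.prob p A = (\<Sum>\<^sub>\<infinity>x\<in>A. pmf p x)"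
  by (simp add: measure_pmf_conv_infsetsum infsetsum_infsum pmf_abs_summable)

lemma integrable_pmf_bounded:
  fixes f :: "'a \<Rightarrow> real"
  assumes "\<And>x. \<bar>f x\<bar> \<le> B"
  shows "integrable (measure_pmf p) f"
  by (rule measure_pmf.integrable_const_bound [where B = B]) (use assms in auto)

lemma abs_pmf_mult_summable_on:
  fixes f :: "'a \<Rightarrow> real"
  assumes "\<And>x. \<bar>f x\<bar> \<le> B"
  shows "(\<lambda>x. norm (pmf p x * f x)) summable_on A"
proof (rule Infinite_Sum.abs_summable_on_comparison_test')
  show "(\<lambda>x. pmf p x * B) summable_on A"
    by (intro summable_on_cmult_left pmf_summable_on)
qed (use assms in \<open>auto simp: abs_mult intro!: mult_left_mono\<close>)

text \<open>Links the infinite sums of the drift condition and of the norms with integrals, for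
  which dominated convergence and iterated expectation are at hand. Boundedness of \<open>f\<close>
  supplies absolute summability.\<close>

lemma expectation_eq_infsum:
  fixes f :: "'a \<Rightarrow> real"
  assumes "\<And>x. \<bar>f x\<bar> \<le> B"
  shows "measure_pmf.expectation p f = (\<Sum>\<^sub>\<infinity>x. pmf p x * f x)"
  unfolding pmf_expectation_eq_infsetsum
  by (intro infsetsum_infsum abs_summable_equivalent [THEN iffD1] abs_pmf_mult_summable_on [OF assms])

lemma abs_expectation_le:
  fixes f :: "'a \<Rightarrow> real"
  assumes "\<And>x. \<bar>f x\<bar> \<le> B"
  shows "\<bar>measure_pmf.expectation p f\<bar> \<le> B"
proof -
  have "\<bar>measure_pmf.expectation p f\<bar> \<le> measure_pmf.expectation p (\<lambda>x. \<bar>f x\<bar>)"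
    by (rule integral_abs_bound)
  also have "\<dots> \<le> measure_pmf.expectation p (\<lambda>_. B)"
    using assms by (intro integral_mono integrable_pmf_bounded [where B = B])
      (auto intro: order_trans [OF abs_ge_zero])
  finally show ?thesis by simp
qed

lemma expectation_bind_pmf_bounded:
  fixes f :: "'b \<Rightarrow> real"
  assumes "\<And>x. \<bar>f x\<bar> \<le> B"
  shows "measure_pmf.expectation (bind_pmf p q) f =
    measure_pmf.expectation p (\<lambda>x. measure_pmf.expectation (q x) f)"
proof -
  have N: "(\<lambda>x. measure_pmf (q x)) \<in> measurable (measure_pmf p) (subprob_algebra (count_space UNIV))"
    by (simp add: measurable_def space_subprob_algebra measure_pmf.subprob_space_axioms
        measure_pmf_in_subprob_algebra)
  show ?thesis
    unfolding measure_pmf_bind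
    by (rule integral_bind [OF _ _ N, where B' = 1 and B = B])
       (use assms in \<open>auto simp: measure_pmf.emeasure_space_1 intro: measure_pmf.finite_measure\<close>)
qed

section \<open>Invariant laws of irreducible chains\<close>

lemma bind_nstep_invariant:
  assumes "invariant_pmf P \<pi>"
  shows "bind_pmf \<pi> (nstep P n) = \<pi>"
proof (induction n)
  case (Suc n)
  have "nstep P (Suc n) = (\<lambda>i. bind_pmf (P i) (nstep P n))" by (rule ext) simp
  then have "bind_pmf \<pi> (nstep P (Suc n)) = bind_pmf (bind_pmf \<pi> P) (nstep P n)"
    by (simp only: bind_assoc_pmf)
  also have "\<dots> = \<pi>"
    using assms by (simp only: Suc invariant_pmf_def)
  finally show ?case .
qed (simp add: bind_return_pmf')

text \<open>Some state \<open>i\<close> carries mass, \<open>j\<close> is reachable from it in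
  \<open>n\<close> steps, and \<pi> is also invariant under the \<open>n\<close>-step kernel, so
  part of the mass of \<open>i\<close> arrives at \<open>j\<close>.\<close>

lemma invariant_pmf_pos:
  assumes "irreducible_chain P" "invariant_pmf P \<pi>"
  shows "0 < pmf \<pi> j"
proof -
  obtain i where i: "i \<in> set_pmf \<pi>" using set_pmf_not_empty by fast
  obtain n where "0 < pmf (nstep P n i) j"
    using assms(1) by (auto simp: irreducible_chain_def)
  then have "j \<in> set_pmf (bind_pmf \<pi> (nstep P n))"
    using i by (auto intro: bexI [OF _ i] simp: pmf_positive_iff)
  then show ?thesis
    using assms(2) by (simp add: bind_nstep_invariant pmf_positive_iff)
qed

section \<open>Poisson's equation under a bounded drift function\<close>

text \<open>The iterate \<open>G n i\<close> is the expected sum of \<open>f\<close> over the times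
  below \<open>n\<close> before the chain started at \<open>i\<close> first hits
  \<open>i\<^sub>0\<close>. Monotonicity and the bound \<open>V\<close> give a pointwise limit, and
  dominated convergence carries the recursion over to it.\<close>

lemma taboo_poisson_solution:
  fixes V f :: "'a \<Rightarrow> real"
  assumes V: "\<And>i. 0 \<le> V i" "\<And>i. V i \<le> M"
    and drift: "\<And>i. i \<noteq> i\<^sub>0 \<Longrightarrow> measure_pmf.expectation (P i) V \<le> V i - 1"
    and f: "\<And>i. 0 \<le> f i" "\<And>i. f i \<le> 1"
  obtains g where "\<And>i. 0 \<le> g i" "\<And>i. g i \<le> V i"
    "\<And>i. i \<noteq> i\<^sub>0 \<Longrightarrow> g i = f i + measure_pmf.expectation (P i) g"
proof -
  define G :: "nat \<Rightarrow> 'a \<Rightarrow> real" where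
    "G = rec_nat (\<lambda>_. 0) (\<lambda>_ u i. if i = i\<^sub>0 then 0 else f i + measure_pmf.expectation (P i) u)"
  have G0: "G 0 i = 0" for i by (simp add: G_def)
  have GSuc: "G (Suc n) i = (if i = i\<^sub>0 then 0 else f i + measure_pmf.expectation (P i) (G n))"
    for n i by (simp add: G_def)
  have Gb: "0 \<le> G n i \<and> G n i \<le> V i" for n i
  proof (induction n arbitrary: i)
    case 0
    then show ?case by (simp add: G0 V)
  next
    case (Suc n)
    have "\<bar>G n j\<bar> \<le> M" "\<bar>V j\<bar> \<le> M" for j
      using Suc [of j] V [of j] by auto
    then have "measure_pmf.expectation (P i) (G n) \<le> measure_pmf.expectation (P i) V"
      using Suc by (intro integral_mono integrable_pmf_bounded [where B = M]) auto
    moreover have "0 \<le> measure_pmf.expectation (P i) (G n)"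
      using Suc by (simp add: integral_nonneg)
    \<comment> \<open>Off \<open>i\<^sub>0\<close>, \<open>f\<close> plus the mean of
      \<open>G n\<close> is at most 1 plus the mean of \<open>V\<close>, hence at most
      \<open>V i\<close> by the drift condition; at \<open>i\<^sub>0\<close> the iterate is
      0.\<close>
    ultimately show ?case
      using drift [of i] f [of i] V [of i] by (auto simp: GSuc)
  qed
  have GM: "\<bar>G n i\<bar> \<le> M" for n i using Gb [of n i] V [of i] by auto
  have mono: "G n i \<le> G (Suc n) i" for n i
  proof (induction n arbitrary: i)
    case 0
    then show ?case using Gb by (simp add: G0)
  next
    case (Suc n)
    have "measure_pmf.expectation (P i) (G n) \<le> measure_pmf.expectation (P i) (G (Suc n))"
      using Suc GM by (intro integral_mono integrable_pmf_bounded [where B = M]) auto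
    then show ?case by (simp add: GSuc [of "Suc n"] GSuc [of n])
  qed
  have "\<exists>g. (\<lambda>n. G n i) \<longlonglongrightarrow> g" for i
    using GM mono by (intro Bseq_mono_convergent [unfolded convergent_def] BseqI' [where K = M])
      (auto intro: lift_Suc_mono_le)
  then obtain g where g: "\<And>i. (\<lambda>n. G n i) \<longlonglongrightarrow> g i" by metis
  show thesis
  proof
    show "0 \<le> g i" for i using g [of i] Gb by (intro LIMSEQ_le_const) auto
    show "g i \<le> V i" for i using g [of i] Gb by (intro LIMSEQ_le_const2) auto
    show "g i = f i + measure_pmf.expectation (P i) g" if "i \<noteq> i\<^sub>0" for i
    proof (rule LIMSEQ_unique)
      show "(\<lambda>n. G (Suc n) i) \<longlonglongrightarrow> g i" using g by (rule LIMSEQ_Suc)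
      have "(\<lambda>n. measure_pmf.expectation (P i) (G n)) \<longlonglongrightarrow> measure_pmf.expectation (P i) g"
        by (rule integral_dominated_convergence [where w = "\<lambda>_. M"]) (use g GM in auto)
      then show "(\<lambda>n. G (Suc n) i) \<longlonglongrightarrow> f i + measure_pmf.expectation (P i) g"
        using that by (auto simp: GSuc intro!: tendsto_intros)
    qed
  qed
qed

lemma poisson_solution:
  fixes V :: "'a \<Rightarrow> real"
  assumes P: "irreducible_chain P" "invariant_pmf P \<pi>"
    and V: "\<And>i. 0 \<le> V i" "\<And>i. V i \<le> M"
    and drift: "\<And>i. i \<noteq> i\<^sub>0 \<Longrightarrow> measure_pmf.expectation (P i) V \<le> V i - 1"
  obtains g where "\<And>i. \<bar>g i\<bar> \<le> M"
    "\<And>i. g i - measure_pmf.expectation (P i) g = indicator A i - measure_pmf.prob \<pi> A"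
proof -
  obtain a where a: "\<And>i. 0 \<le> a i" "\<And>i. a i \<le> V i"
    "\<And>i. i \<noteq> i\<^sub>0 \<Longrightarrow> a i = indicator A i + measure_pmf.expectation (P i) a"
    using taboo_poisson_solution [OF V drift, where f = "indicator A"] by (auto simp: indicator_le_1)
  obtain b where b: "\<And>i. 0 \<le> b i" "\<And>i. b i \<le> V i"
    "\<And>i. i \<noteq> i\<^sub>0 \<Longrightarrow> b i = 1 + measure_pmf.expectation (P i) b"
    using taboo_poisson_solution [OF V drift, where f = "\<lambda>_. 1"] by auto
  define c where "c = measure_pmf.prob \<pi> A"
  define g where "g i = a i - c * b i" for i
  have c: "0 \<le> c" "c \<le> 1" by (simp_all add: c_def)
  have ab: "\<bar>a i\<bar> \<le> M" "\<bar>b i\<bar> \<le> M" for i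
    using a(1,2) [of i] b(1,2) [of i] V(2) [of i] by auto
  \<comment> \<open>Both \<open>a i\<close> and \<open>c * b i\<close> lie between 0 and
    \<open>M\<close>, so their difference is bounded by \<open>M\<close> without a factor 2.\<close>
  have gM: "\<bar>g i\<bar> \<le> M" for i
  proof -
    have "0 \<le> c * b i" "c * b i \<le> 1 * b i"
      using b(1) [of i] c by (intro mult_right_mono mult_nonneg_nonneg; simp)+
    then show ?thesis
      using a(1,2) [of i] b(1,2) [of i] V(2) [of i] by (simp add: g_def abs_le_iff)
  qed
  have int: "integrable (measure_pmf p) a" "integrable (measure_pmf p) b"
    "integrable (measure_pmf p) g" for p :: "'a pmf"
    using ab gM by (auto intro!: integrable_pmf_bounded [where B = M])
  have Eg: "measure_pmf.expectation (P i) g =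
      measure_pmf.expectation (P i) a - c * measure_pmf.expectation (P i) b" for i
    unfolding g_def using int by simp
  \<comment> \<open>The residual of Poisson's equation. Its \<pi>-mean is 0 by invariance and the
    choice of \<open>c\<close>; as it vanishes off \<open>i\<^sub>0\<close>, that mean is just
    \<open>pmf \<pi> i\<^sub>0 * r i\<^sub>0\<close>.\<close>
  define r where "r i = g i - measure_pmf.expectation (P i) g - (indicator A i - c)" for i
  have r0: "r i = 0" if "i \<noteq> i\<^sub>0" for i
    using a(3) [OF that] b(3) [OF that] unfolding r_def Eg g_def by (simp add: algebra_simps)
  have "measure_pmf.expectation \<pi> r =
      measure_pmf.expectation \<pi> g - measure_pmf.expectation \<pi> (\<lambda>i. measure_pmf.expectation (P i) g) - (c - c)"
  proof -
    have "integrable (measure_pmf \<pi>) (\<lambda>i. measure_pmf.expectation (P i) g)"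
      by (intro integrable_pmf_bounded [where B = M] abs_expectation_le gM)
    moreover have "integrable (measure_pmf \<pi>) (indicator A :: _ \<Rightarrow> real)"
      by (intro integrable_pmf_bounded [where B = 1]) (auto simp: indicator_def)
    ultimately show ?thesis unfolding r_def using int(3)
      by (simp add: c_def)
  qed
  also have "\<dots> = 0"
    using expectation_bind_pmf_bounded [OF gM, of \<pi> P] P(2) by (simp add: invariant_pmf_def)
  also have "measure_pmf.expectation \<pi> r = pmf \<pi> i\<^sub>0 * r i\<^sub>0"
    by (subst integral_measure_pmf_real [where A = "{i\<^sub>0}"]) (use r0 in auto)
  finally have "r i\<^sub>0 = 0"
    using invariant_pmf_pos [OF P, of i\<^sub>0] by simp
  with r0 have "r i = 0" for i by (cases "i = i\<^sub>0") auto
  then show thesis using gM by (intro that [of g]) (auto simp: r_def c_def)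
qed

section \<open>Perturbation bound from a drift function\<close>

lemma prob_diff_le:
  fixes V :: "'a \<Rightarrow> real"
  assumes P: "irreducible_chain P" "invariant_pmf P \<pi>" "invariant_pmf P' \<nu>"
    and V: "\<And>i. 0 \<le> V i" "\<And>i. V i \<le> M"
    and drift: "\<And>i. i \<noteq> i\<^sub>0 \<Longrightarrow> measure_pmf.expectation (P i) V \<le> V i - 1"
    and C: "\<And>i. (\<Sum>\<^sub>\<infinity>j. \<bar>pmf (P' i) j - pmf (P i) j\<bar>) \<le> C"
  shows "measure_pmf.prob \<nu> A - measure_pmf.prob \<pi> A \<le> M * C"
proof -
  obtain g where g: "\<And>i. \<bar>g i\<bar> \<le> M"
    "\<And>i. g i - measure_pmf.expectation (P i) g = indicator A i - measure_pmf.prob \<pi> A"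
    using poisson_solution [OF P(1,2) V drift] by metis
  have M: "0 \<le> M" using V(1,2) [of i\<^sub>0] by linarith
  \<comment> \<open>Each row is estimated by the supremum of \<open>g\<close> times the absolute row
    sum of the perturbation.\<close>
  have diff: "measure_pmf.expectation (P' i) g - measure_pmf.expectation (P i) g \<le> M * C" for i
  proof -
    let ?d = "\<lambda>j. pmf (P' i) j * g j - pmf (P i) j * g j"
    have le: "norm (?d j) \<le> M * \<bar>pmf (P' i) j - pmf (P i) j\<bar>" for j
      using mult_right_mono [OF g(1) [of j] abs_ge_zero, of "pmf (P' i) j - pmf (P i) j"]
      by (simp only: mult.commute [of "g j"] real_norm_def flip: left_diff_distrib abs_mult)
    have s: "(\<lambda>j. norm (?d j)) summable_on UNIV"
      by (rule Infinite_Sum.abs_summable_on_comparison_test' [OF summable_on_cmult_right [OF abs_pmf_diff_summable_on] le])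
    have "measure_pmf.expectation (P' i) g - measure_pmf.expectation (P i) g = infsum ?d UNIV"
      by (simp only: expectation_eq_infsum [OF g(1)] infsum_diff
          abs_summable_summable [OF abs_pmf_mult_summable_on [OF g(1)]])
    also have "\<dots> \<le> norm (infsum ?d UNIV)" by simp
    also have "\<dots> \<le> (\<Sum>\<^sub>\<infinity>j. norm (?d j))" by (rule norm_infsum_bound [OF s])
    also have "\<dots> \<le> (\<Sum>\<^sub>\<infinity>j. M * \<bar>pmf (P' i) j - pmf (P i) j\<bar>)"
      by (rule infsum_mono [OF s summable_on_cmult_right [OF abs_pmf_diff_summable_on] le])
    also have "\<dots> \<le> M * C"
      using C M by (simp add: infsum_cmult_right' mult_left_mono)
    finally show ?thesis .
  qed
  have int: "integrable (measure_pmf \<nu>) (\<lambda>i. measure_pmf.expectation (Q i) g)" for Q :: "'a \<Rightarrow> 'a pmf"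
    by (intro integrable_pmf_bounded [where B = M] abs_expectation_le g(1))
  have ind: "integrable (measure_pmf \<nu>) (indicator A :: _ \<Rightarrow> real)"
    by (intro integrable_pmf_bounded [where B = 1]) (auto simp: indicator_def)
  have "measure_pmf.prob \<nu> A - measure_pmf.prob \<pi> A =
      measure_pmf.expectation \<nu> (\<lambda>i. indicator A i - measure_pmf.prob \<pi> A)"
    using ind by simp
  also have "\<dots> = measure_pmf.expectation \<nu> (\<lambda>i. g i - measure_pmf.expectation (P i) g)"
    by (simp add: g(2))
  also have "\<dots> = measure_pmf.expectation \<nu> g - measure_pmf.expectation \<nu> (\<lambda>i. measure_pmf.expectation (P i) g)"
    by (intro Bochner_Integration.integral_diff int integrable_pmf_bounded [where B = M] g(1))
  \<comment> \<open>Invariance of \<nu> under \<open>P'\<close> puts \<open>P'\<close> in front of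
    \<open>g\<close>, so that only the difference of the two kernels remains.\<close>
  also have "measure_pmf.expectation \<nu> g = measure_pmf.expectation \<nu> (\<lambda>i. measure_pmf.expectation (P' i) g)"
    using expectation_bind_pmf_bounded [OF g(1), of \<nu> P'] P(3) by (simp add: invariant_pmf_def)
  also have "\<dots> - measure_pmf.expectation \<nu> (\<lambda>i. measure_pmf.expectation (P i) g) =
      measure_pmf.expectation \<nu> (\<lambda>i. measure_pmf.expectation (P' i) g - measure_pmf.expectation (P i) g)"
    by (intro Bochner_Integration.integral_diff [symmetric] int)
  also have "\<dots> \<le> measure_pmf.expectation \<nu> (\<lambda>_. M * C)"
    by (intro integral_mono Bochner_Integration.integrable_diff int diff) simp
  finally show ?thesis by simp
qed

text \<open>Both laws have total mass 1, so the positive and negative parts of their difference have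
  equal sums. The witness is the positive set of the Hahn decomposition of \<nu> - \<pi>.\<close>

lemma infsum_abs_pmf_diff_attained:
  "\<exists>A. (\<Sum>\<^sub>\<infinity>i. \<bar>pmf \<nu> i - pmf \<pi> i\<bar>) = 2 * (measure_pmf.prob \<nu> A - measure_pmf.prob \<pi> A)"
proof
  define A where "A = {i. pmf \<pi> i \<le> pmf \<nu> i}"
  have "(\<Sum>\<^sub>\<infinity>i. \<bar>pmf \<nu> i - pmf \<pi> i\<bar>) =
      (\<Sum>\<^sub>\<infinity>i\<in>A. \<bar>pmf \<nu> i - pmf \<pi> i\<bar>) + (\<Sum>\<^sub>\<infinity>i\<in>-A. \<bar>pmf \<nu> i - pmf \<pi> i\<bar>)"
    by (subst infsum_Un_disjoint [symmetric])
       (auto simp: Compl_partition intro: abs_pmf_diff_summable_on)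
  also have "(\<Sum>\<^sub>\<infinity>i\<in>A. \<bar>pmf \<nu> i - pmf \<pi> i\<bar>) = (\<Sum>\<^sub>\<infinity>i\<in>A. pmf \<nu> i - pmf \<pi> i)"
    by (intro infsum_cong) (auto simp: A_def)
  also have "\<dots> = measure_pmf.prob \<nu> A - measure_pmf.prob \<pi> A"
    by (simp add: measure_pmf_eq_infsum infsum_diff pmf_summable_on)
  also have "(\<Sum>\<^sub>\<infinity>i\<in>-A. \<bar>pmf \<nu> i - pmf \<pi> i\<bar>) = (\<Sum>\<^sub>\<infinity>i\<in>-A. pmf \<pi> i - pmf \<nu> i)"
    by (intro infsum_cong) (auto simp: A_def)
  also have "\<dots> = measure_pmf.prob \<pi> (-A) - measure_pmf.prob \<nu> (-A)"
    by (simp add: measure_pmf_eq_infsum infsum_diff pmf_summable_on)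
  also have "\<dots> = measure_pmf.prob \<nu> A - measure_pmf.prob \<pi> A"
    using measure_pmf.prob_compl [of A \<pi>] measure_pmf.prob_compl [of A \<nu>]
    by (simp add: Compl_eq_Diff_UNIV)
  finally show "(\<Sum>\<^sub>\<infinity>i. \<bar>pmf \<nu> i - pmf \<pi> i\<bar>) = 2 * (measure_pmf.prob \<nu> A - measure_pmf.prob \<pi> A)"
    by simp
qed

lemma vector_norm_pmf_diff:
  "vector_norm (\<lambda>i. pmf p i - pmf q i) = ennreal (\<Sum>\<^sub>\<infinity>i. \<bar>pmf p i - pmf q i\<bar>)"
  unfolding vector_norm_def by (intro infsum_ennreal abs_pmf_diff_summable_on) simp

lemma infsum_abs_pmf_diff_le_2: "(\<Sum>\<^sub>\<infinity>i. \<bar>pmf p i - pmf q i\<bar>) \<le> 2"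
proof -
  obtain A where "(\<Sum>\<^sub>\<infinity>i. \<bar>pmf p i - pmf q i\<bar>) = 2 * (measure_pmf.prob p A - measure_pmf.prob q A)"
    using infsum_abs_pmf_diff_attained by blast
  also have "\<dots> \<le> 2"
    using diff_mono [OF measure_pmf.prob_le_1 [of p A] measure_nonneg [of q A]] by simp
  finally show ?thesis .
qed

text \<open>Provides finiteness: the norm can be treated as a real number and divided by.\<close>

lemma matrix_norm_pmf_diff_le_2: "matrix_norm (\<lambda>i j. pmf (P' i) j - pmf (P i) j) \<le> 2"
  unfolding matrix_norm_def vector_norm_def [symmetric] vector_norm_pmf_diff
  by (intro SUP_least) (simp add: ennreal_le_iff2 infsum_abs_pmf_diff_le_2 flip: ennreal_numeral)

text \<open>The maximizing set turns the bound on single events into \<open>2 * (M * C)\<close>, and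
  \<open>M\<close> is at most its square when it is 0 or at least 1. Since \<open>M\<close> is any
  upper bound of \<open>V\<close>, this serves both the given \<open>V\<close> and the mean hitting
  times.\<close>

lemma vector_norm_diff_le_drift:
  fixes V :: "'a \<Rightarrow> real"
  assumes P: "irreducible_chain P" "invariant_pmf P \<pi>" "invariant_pmf P' \<nu>"
    and V: "\<And>i. 0 \<le> V i" "\<And>i. V i \<le> M" "M = 0 \<or> 1 \<le> M"
    and drift: "\<And>i. i \<noteq> i\<^sub>0 \<Longrightarrow> measure_pmf.expectation (P i) V \<le> V i - 1"
  shows "vector_norm (\<lambda>i. pmf \<nu> i - pmf \<pi> i) \<le>
    2 * ennreal M ^ 2 * matrix_norm (\<lambda>i j. pmf (P' i) j - pmf (P i) j)"
proof -
  let ?\<Delta> = "\<lambda>i j. pmf (P' i) j - pmf (P i) j"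
  define C where "C = enn2real (matrix_norm ?\<Delta>)"
  have "matrix_norm ?\<Delta> < top"
    using matrix_norm_pmf_diff_le_2 [of P' P] by (rule order.strict_trans1) simp
  then have C: "matrix_norm ?\<Delta> = ennreal C" by (simp add: C_def)
  have "0 \<le> C" by (simp add: C_def)
  have rows: "(\<Sum>\<^sub>\<infinity>j. \<bar>?\<Delta> i j\<bar>) \<le> C" for i
  proof -
    have "ennreal (\<Sum>\<^sub>\<infinity>j. \<bar>?\<Delta> i j\<bar>) \<le> matrix_norm ?\<Delta>"
      unfolding matrix_norm_def vector_norm_def [symmetric] vector_norm_pmf_diff
      by (rule SUP_upper) simp
    then show ?thesis using \<open>0 \<le> C\<close> by (simp add: C)
  qed
  obtain A where "(\<Sum>\<^sub>\<infinity>i. \<bar>pmf \<nu> i - pmf \<pi> i\<bar>) = 2 * (measure_pmf.prob \<nu> A - measure_pmf.prob \<pi> A)"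
    using infsum_abs_pmf_diff_attained by blast
  also have "\<dots> \<le> 2 * (M * C)"
    using prob_diff_le [OF P V(1,2) drift rows] by (intro mult_left_mono) auto
  also have "\<dots> \<le> 2 * (M ^ 2 * C)"
    using V(3) \<open>0 \<le> C\<close> by (intro mult_left_mono mult_right_mono) (auto simp: power2_eq_square)
  finally have "vector_norm (\<lambda>i. pmf \<nu> i - pmf \<pi> i) \<le> ennreal (2 * (M ^ 2 * C))"
    unfolding vector_norm_pmf_diff by (rule ennreal_leI)
  also have "\<dots> = 2 * ennreal M ^ 2 * ennreal C"
    using V(3) \<open>0 \<le> C\<close> by (auto simp: ennreal_mult ennreal_power mult.assoc)
  finally show ?thesis by (simp add: C)
qed

section \<open>Laws of finite path segments\<close>

text \<open>The law of the first \<open>n + 1\<close> states. Whereas \<open>chain\<close> appends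
  the last step, this recursion splits off the first one, which makes first-step analysis immediate
  and avoids shifting the product space.\<close>

primrec path_pmf :: "('a \<Rightarrow> 'a pmf) \<Rightarrow> nat \<Rightarrow> 'a \<Rightarrow> 'a list pmf" where
  "path_pmf P 0 i = return_pmf [i]"
| "path_pmf P (Suc n) i = map_pmf ((#) i) (bind_pmf (P i) (path_pmf P n))"

lemma pmf_path_pmf:
  "pmf (path_pmf P n i) xs =
    (if length xs = Suc n \<and> hd xs = i then \<Prod>k<n. pmf (P (xs ! k)) (xs ! Suc k) else 0)"
proof (induction n arbitrary: i xs)
  case 0
  show ?case by (cases xs) (auto simp: pmf_return)
next
  case (Suc n)
  show ?case
  proof (cases "xs \<noteq> [] \<and> hd xs = i")
    case False
    then have "xs \<notin> set_pmf (path_pmf P (Suc n) i)" by auto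
    with False show ?thesis by (simp add: set_pmf_iff del: path_pmf.simps) auto
  next
    case True
    then obtain ys where xs: "xs = i # ys" by (cases xs) auto
    let ?c = "if length ys = Suc n then \<Prod>k<n. pmf (P (ys ! k)) (ys ! Suc k) else 0"
    have "pmf (path_pmf P (Suc n) i) xs = measure_pmf.expectation (P i) (\<lambda>j. pmf (path_pmf P n j) ys)"
      by (simp add: xs pmf_map_inj' pmf_bind)
    \<comment> \<open>Only the start \<open>j = hd ys\<close> can produce \<open>ys\<close>, so the
      mean over the first step collapses to one term. For empty \<open>ys\<close> the head is
      unspecified, but then \<open>?c\<close> is 0.\<close>
    also have "\<dots> = measure_pmf.expectation (P i) (\<lambda>j. indicator {hd ys} j * ?c)"
      by (intro Bochner_Integration.integral_cong) (auto simp: Suc indicator_def)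
    also have "\<dots> = pmf (P i) (hd ys) * ?c"
      by (simp add: measure_pmf_single)
    also have "\<dots> = (if length xs = Suc (Suc n) \<and> hd xs = i
        then \<Prod>k<Suc n. pmf (P (xs ! k)) (xs ! Suc k) else 0)"
      unfolding prod.lessThan_Suc_shift by (cases ys) (auto simp: xs)
    finally show ?thesis .
  qed
qed

lemma path_eq_iff:
  "map (\<lambda>k. chain i k \<omega>) [0..<Suc n] = xs \<longleftrightarrow>
    length xs = Suc n \<and> (\<forall>k\<le>n. chain i k \<omega> = xs ! k)"
  by (auto simp: list_eq_iff_nth_eq less_Suc_eq_le simp del: upt_Suc)

text \<open>Lists over a countable type are countable, so it suffices that preimages of single
  lists, which are cylinder events, are measurable.\<close>

lemma measurable_path [measurable]:
  fixes P :: "'a::countable \<Rightarrow> 'a pmf"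
  shows "(\<lambda>\<omega>. map (\<lambda>k. chain i k \<omega>) [0..<Suc n]) \<in>
    measurable (chain_space P) (count_space UNIV)"
proof -
  have "(\<lambda>\<omega>. map (\<lambda>k. chain i k \<omega>) [0..<Suc n]) -` {xs} \<inter> space (chain_space P) \<in> sets (chain_space P)" for xs
  proof -
    have "{\<omega> \<in> space (chain_space P). length xs = Suc n \<and> (\<forall>k\<le>n. chain i k \<omega> = xs ! k)} \<in> sets (chain_space P)"
      by measurable
    then show ?thesis by (simp add: path_eq_iff vimage_def del: upt_Suc)
  qed
  then show ?thesis by (simp add: measurable_count_space_eq2_countable del: upt_Suc)
qed

text \<open>On a countable space it is enough to compare singletons; there both sides are the same
  product of transition probabilities, by \<open>chain_finite_paths\<close> and
  \<open>pmf_path_pmf\<close>.\<close>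

lemma distr_path_eq_path_pmf:
  fixes P :: "'a::countable \<Rightarrow> 'a pmf"
  shows "distr (chain_space P) (count_space UNIV) (\<lambda>\<omega>. map (\<lambda>k. chain i k \<omega>) [0..<Suc n]) =
    measure_pmf (path_pmf P n i)"
proof (rule measure_eqI_countable [where A = UNIV])
  fix xs :: "'a list"
  interpret prob_space "chain_space P" by (rule prob_space_chain_space)
  have "emeasure (distr (chain_space P) (count_space UNIV) (\<lambda>\<omega>. map (\<lambda>k. chain i k \<omega>) [0..<Suc n])) {xs} =
      emeasure (chain_space P) {\<omega>. length xs = Suc n \<and> (\<forall>k\<le>n. chain i k \<omega> = xs ! k)}"
    by (subst emeasure_distr) (auto simp: path_eq_iff vimage_def simp del: upt_Suc)
  also have "\<dots> = ennreal (pmf (path_pmf P n i) xs)"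
    using chain_finite_paths [where P = P and i = i and n = n and x = "nth xs"]
    by (cases "length xs = Suc n"; cases xs) (auto simp: emeasure_eq_measure pmf_path_pmf)
  finally show "emeasure (distr (chain_space P) (count_space UNIV) (\<lambda>\<omega>. map (\<lambda>k. chain i k \<omega>) [0..<Suc n])) {xs} =
      emeasure (measure_pmf (path_pmf P n i)) {xs}"
    by (simp add: emeasure_pmf_single)
qed auto

lemma emeasure_not_hit_eq:
  fixes P :: "'a::countable \<Rightarrow> 'a pmf"
  shows "emeasure (chain_space P) {\<omega>. \<forall>m\<le>n. chain i m \<omega> \<noteq> k} =
    emeasure (path_pmf P n i) {xs. k \<notin> set xs}"
  unfolding distr_path_eq_path_pmf [symmetric]
  by (subst emeasure_distr)
     (auto simp: vimage_def atLeast0LessThan less_Suc_eq_le simp del: upt_Suc intro!: arg_cong [where f = "emeasure _"])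

text \<open>The Markov property at time 1 in the form needed: as \<open>i\<close> differs from
  \<open>k\<close>, a path avoids \<open>k\<close> exactly if its tail does, and
  \<open>path_pmf\<close> averages the tail over the first step.\<close>

lemma emeasure_not_hit_Suc:
  fixes P :: "'a::countable \<Rightarrow> 'a pmf"
  assumes "i \<noteq> k"
  shows "emeasure (chain_space P) {\<omega>. \<forall>m\<le>Suc n. chain i m \<omega> \<noteq> k} =
    (\<integral>\<^sup>+j. emeasure (chain_space P) {\<omega>. \<forall>m\<le>n. chain j m \<omega> \<noteq> k} \<partial>P i)"
  using assms by (simp add: emeasure_not_hit_eq vimage_def)

section \<open>Mean hitting times and first-step analysis\<close>

text \<open>Counts the times \<open>n\<close> that the hitting time exceeds. If \<open>k\<close> is
  never hit, all terms are 1 and the sum is \<open>top\<close>, in agreement with the infimum of the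
  empty set.\<close>

lemma hitting_time_eq_suminf:
  "hitting_time \<phi> k = (\<Sum>n. indicator {n. \<forall>m\<le>n. \<phi> m \<noteq> k} n)"
proof (cases "\<exists>n. \<phi> n = k")
  case False
  have "(\<Sum>n::nat. 1 :: ennreal) = top"
    by (subst suminf_eq_SUP) (simp add: ennreal_SUP_of_nat_eq_top)
  with False show ?thesis by (simp add: hitting_time_def indicator_def)
next
  case True
  define N where "N = (LEAST n. \<phi> n = k)"
  have N: "\<phi> N = k" "N \<le> n" if "\<phi> n = k" for n
    using that unfolding N_def by (auto intro: LeastI Least_le)
  with True have "\<phi> N = k" by blast
  have "hitting_time \<phi> k = of_nat N"
    unfolding hitting_time_def
    by (intro antisym INF_lower INF_greatest) (use N \<open>\<phi> N = k\<close> in auto)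
  also have "{n. \<forall>m\<le>n. \<phi> m \<noteq> k} = {..<N}"
    using N(2) \<open>\<phi> N = k\<close> by (auto simp: not_less[symmetric]) (meson le_trans not_less)+
  then have "(\<Sum>n. indicator {n. \<forall>m\<le>n. \<phi> m \<noteq> k} n :: ennreal) = of_nat N"
    by (subst suminf_finite [of "{..<N}"]) auto
  finally show ?thesis by simp
qed

lemma mean_hitting_time_eq_suminf:
  fixes P :: "'a::countable \<Rightarrow> 'a pmf"
  shows "mean_hitting_time P i k =
    (\<Sum>n. emeasure (chain_space P) {\<omega>. \<forall>m\<le>n. chain i m \<omega> \<noteq> k})"
proof -
  have [measurable]: "{\<omega>. \<forall>m\<le>n. chain i m \<omega> \<noteq> k} \<in> sets (chain_space P)" for n
  proof -
    have "{\<omega> \<in> space (chain_space P). \<forall>m\<le>n. chain i m \<omega> \<noteq> k} \<in> sets (chain_space P)"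
      by measurable
    then show ?thesis by simp
  qed
  have "mean_hitting_time P i k =
      (\<integral>\<^sup>+\<omega>. (\<Sum>n. indicator {\<omega>. \<forall>m\<le>n. chain i m \<omega> \<noteq> k} \<omega>) \<partial>chain_space P)"
    by (simp add: mean_hitting_time_def hitting_time_eq_suminf indicator_def)
  also have "\<dots> = (\<Sum>n. emeasure (chain_space P) {\<omega>. \<forall>m\<le>n. chain i m \<omega> \<noteq> k})"
    by (subst nn_integral_suminf) auto
  finally show ?thesis .
qed

lemma mean_hitting_time_self: "mean_hitting_time P k k = 0"
proof -
  have "hitting_time (\<lambda>n. chain k n \<omega>) k = 0" for \<omega>
    unfolding hitting_time_def by (intro antisym INF_lower2 [of 0]) auto
  then show ?thesis by (simp add: mean_hitting_time_def)
qed

text \<open>In the sum of the tail probabilities the term for time 0 is 1, and each later one is the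
  mean over the first step of its predecessor. Working in \<open>ennreal\<close> covers infinite
  means too.\<close>

lemma mean_hitting_time_step:
  fixes P :: "'a::countable \<Rightarrow> 'a pmf"
  assumes "i \<noteq> k"
  shows "mean_hitting_time P i k = 1 + (\<integral>\<^sup>+j. mean_hitting_time P j k \<partial>P i)"
proof -
  interpret prob_space "chain_space P" by (rule prob_space_chain_space)
  let ?S = "\<lambda>n i. emeasure (chain_space P) {\<omega>. \<forall>m\<le>n. chain i m \<omega> \<noteq> k}"
  have "mean_hitting_time P i k = ?S 0 i + (\<Sum>n. ?S (Suc n) i)"
    unfolding mean_hitting_time_eq_suminf
    using suminf_offset [of "\<lambda>n. ?S n i" 1] by simp
  also have "?S 0 i = 1" using assms emeasure_space_1 by simp
  also have "(\<Sum>n. ?S (Suc n) i) = (\<integral>\<^sup>+j. (\<Sum>n. ?S n j) \<partial>P i)"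
    by (simp only: emeasure_not_hit_Suc [OF assms]) (simp add: nn_integral_suminf)
  finally show ?thesis by (simp add: mean_hitting_time_eq_suminf)
qed

section \<open>The bounds for the invariant laws\<close>

text \<open>A finite supremum makes the mean hitting times of \<open>k\<close> a bounded drift
  function, with equality in the drift condition. An infinite one makes the right-hand side
  \<open>top\<close>; this is where the norm must be nonzero, because 0 times \<open>top\<close> is
  0 in \<open>ennreal\<close>.\<close>

lemma vector_norm_diff_le_hitting:
  fixes P P' :: "'a::countable \<Rightarrow> 'a pmf"
  assumes P: "irreducible_chain P" "invariant_pmf P \<pi>" "invariant_pmf P' \<nu>"
    and "matrix_norm (\<lambda>i j. pmf (P' i) j - pmf (P i) j) \<noteq> 0"
  shows "vector_norm (\<lambda>i. pmf \<nu> i - pmf \<pi> i) \<le>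
    2 * (SUP i. mean_hitting_time P i k) ^ 2 * matrix_norm (\<lambda>i j. pmf (P' i) j - pmf (P i) j)"
proof (cases "(SUP i. mean_hitting_time P i k) = top")
  case True
  show ?thesis
    unfolding True using assms(4) by (simp add: ennreal_top_mult ennreal_mult_top power2_eq_square)
next
  case False
  define m where "m = enn2real (SUP i. mean_hitting_time P i k)"
  define W where "W i = enn2real (mean_hitting_time P i k)" for i
  have m: "(SUP i. mean_hitting_time P i k) = ennreal m" "0 \<le> m"
    using False by (simp_all only: m_def ennreal_enn2real_if if_False enn2real_nonneg)
  have le: "mean_hitting_time P i k \<le> ennreal m" for i
    unfolding m(1) [symmetric] by (rule SUP_upper) simp
  then have fin: "mean_hitting_time P i k \<noteq> top" for i
    by (metis ennreal_neq_top top_unique)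
  then have W: "mean_hitting_time P i k = ennreal (W i)" "0 \<le> W i" for i
    by (simp_all add: W_def ennreal_enn2real_if)
  have Wm: "W i \<le> m" for i
    using le [of i] m(2) by (simp add: W(1))
  have step: "W i = 1 + measure_pmf.expectation (P i) W" if "i \<noteq> k" for i
  proof -
    have "integrable (measure_pmf (P i)) W"
      using W(2) Wm by (intro integrable_pmf_bounded [where B = m]) simp
    moreover have E: "0 \<le> measure_pmf.expectation (P i) W" using W(2) by simp
    ultimately have "ennreal (W i) = ennreal (1 + measure_pmf.expectation (P i) W)"
      using mean_hitting_time_step [OF that, of P] W(2)
      by (simp add: W(1) nn_integral_eq_integral ennreal_plus)
    then show ?thesis using W(2) [of i] E by (simp only: ennreal_inj add_nonneg_nonneg zero_le_one)
  qed
  \<comment> \<open>Every state other than \<open>k\<close> needs at least one step to reach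
    \<open>k\<close>; if there is no such state, \<open>m\<close> is 0.\<close>
  have "m = 0 \<or> 1 \<le> m"
  proof (cases "\<exists>i. i \<noteq> k")
    case True
    then obtain i where "i \<noteq> k" by blast
    moreover have "0 \<le> measure_pmf.expectation (P i) W" using W(2) by simp
    ultimately show ?thesis using step [of i] Wm [of i] by simp
  next
    case False
    then have "mean_hitting_time P i k = 0" for i by (metis mean_hitting_time_self)
    then show ?thesis by (simp add: m_def)
  qed
  moreover have "measure_pmf.expectation (P i) W \<le> W i - 1" if "i \<noteq> k" for i
    using step [OF that] by simp
  ultimately show ?thesis
    unfolding m(1) by (intro vector_norm_diff_le_drift [OF P W(2) Wm])
qed

theorem theorem2p2:
  fixes P P' :: "'a::countable \<Rightarrow> 'a pmf"
    and \<pi> \<nu> :: "'a pmf"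
    and \<Delta> :: "'a \<Rightarrow> 'a \<Rightarrow> real"
    and i\<^sub>0 :: 'a
    and V :: "'a \<Rightarrow> real"
  assumes "irreducible_chain P" and "positive_recurrent P"
    and "irreducible_chain P'" and "positive_recurrent P'"
    and "invariant_pmf P \<pi>" and "invariant_pmf P' \<nu>"
    and "\<Delta> = (\<lambda>i j. pmf (P' i) j - pmf (P i) j)"
    and "bdd_above (range V)" and "\<And>i. 0 \<le> V i" and "V i\<^sub>0 = 0"
    and "\<And>i. i \<noteq> i\<^sub>0 \<Longrightarrow> (\<Sum>\<^sub>\<infinity>j. pmf (P i) j * V j) \<le> V i - 1"
  shows "vector_norm (\<lambda>i. pmf \<nu> i - pmf \<pi> i) \<le>
           2 * ennreal (SUP i. V i) ^ 2 * matrix_norm \<Delta>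
       \<and> vector_norm (\<lambda>i. pmf \<nu> i - pmf \<pi> i) \<le>
           2 * (INF k. (SUP i. mean_hitting_time P i k) ^ 2) * matrix_norm \<Delta>"
proof
  define M where "M = (SUP i. V i)"
  have VM: "V i \<le> M" for i
    unfolding M_def by (intro cSUP_upper assms(8)) simp
  have "\<bar>V i\<bar> \<le> M" for i using VM assms(9) by simp
  then have drift: "measure_pmf.expectation (P i) V \<le> V i - 1" if "i \<noteq> i\<^sub>0" for i
    using assms(11) [OF that] by (simp add: expectation_eq_infsum [of V M])
  have M: "M = 0 \<or> 1 \<le> M"
  proof (cases "\<exists>i. i \<noteq> i\<^sub>0")
    case True
    then obtain i where "i \<noteq> i\<^sub>0" by blast
    moreover have "0 \<le> measure_pmf.expectation (P i) V"
      using assms(9) by simp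
    ultimately show ?thesis using drift [of i] VM [of i] by simp
  next
    case False
    then have "V i = 0" for i using assms(10) by metis
    then show ?thesis by (simp add: M_def)
  qed
  show first: "vector_norm (\<lambda>i. pmf \<nu> i - pmf \<pi> i) \<le> 2 * ennreal (SUP i. V i) ^ 2 * matrix_norm \<Delta>"
    using vector_norm_diff_le_drift [OF assms(1,5,6,9) VM M drift]
    by (simp add: M_def assms(7))
  show "vector_norm (\<lambda>i. pmf \<nu> i - pmf \<pi> i) \<le>
      2 * (INF k. (SUP i. mean_hitting_time P i k) ^ 2) * matrix_norm \<Delta>"
  proof (cases "matrix_norm \<Delta> = 0")
    \<comment> \<open>The first bound, whose supremum is finite, already forces the left-hand side
      to be 0.\<close>
    case True
    with first show ?thesis by simp
  next
    case False
    let ?D = "2 * matrix_norm \<Delta>"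
    have D: "0 < ?D" "?D \<noteq> top"
      using False matrix_norm_pmf_diff_le_2 [of P' P]
      by (auto simp: assms(7) ennreal_mult_eq_top_iff top_unique zero_less_iff_neq_zero)
    \<comment> \<open>Dividing by the positive finite \<open>?D\<close> isolates the infimum, so
      that a bound for each \<open>k\<close> separately is enough.\<close>
    have "vector_norm (\<lambda>i. pmf \<nu> i - pmf \<pi> i) / ?D \<le> (INF k. (SUP i. mean_hitting_time P i k) ^ 2)"
    proof (rule INF_greatest, rule divide_le_posI_ennreal [OF D(1)])
      fix k
      show "vector_norm (\<lambda>i. pmf \<nu> i - pmf \<pi> i) \<le> ?D * (SUP i. mean_hitting_time P i k) ^ 2"
        using vector_norm_diff_le_hitting [OF assms(1,5,6), of k] False
        by (simp add: assms(7) mult_ac)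
    qed
    then have "vector_norm (\<lambda>i. pmf \<nu> i - pmf \<pi> i) / ?D * ?D \<le>
        (INF k. (SUP i. mean_hitting_time P i k) ^ 2) * ?D"
      by (rule mult_right_mono) simp
    also have "vector_norm (\<lambda>i. pmf \<nu> i - pmf \<pi> i) / ?D * ?D = vector_norm (\<lambda>i. pmf \<nu> i - pmf \<pi> i)"
      using D by (simp only: ennreal_divide_times ennreal_divide_self less_top mult_1_right)
    finally show ?thesis
      by (simp only: mult_ac)
  qed
qed

end
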